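(* (i) For every $n\geq 4$ and every $G\in\mathcal{GAQ}_n$, $G$ is fractional strongly maximally matched, i.e. $fsmp(G)=2n-1$. (ii) For every $n\geq 4$ and every $G\in\mathcal{RGAQ}_n$, $G$ is fractional strongly super matched.
   Context: The $n$-dimensional augmented cube $AQ_n$ ($n\geq 1$) has vertex set all binary strings $u_1u_2\cdots u_n$. $AQ_1\cong K_2$ on vertices $0,1$. For $n\geq 2$, $AQ_n$ consists of a copy $AQ^0_{n-1}$ of $AQ_{n-1}$ with $0$ prefixed to every label and a copy $AQ^1_{n-1}$ with $1$ prefixed, plus the following edges: $0u_1\cdots u_{n-1}$ is adjacent to $1v_1\cdots v_{n-1}$ iff either $u_i=v_i$ for all $i$ (cross edge) or $u_i\neq v_i$ for all $i$ (complement edge). Generalized augmented cubes: $\mathcal{GAQ}_4=\{AQ_4\}$; for $n\geq 5$, $\mathcal{GAQ}_n$ consists of all graphs $(V_1\cup V_2, E_1\cup E_2\cup M_1\cup M_2)$ where $(V_1,E_1),(V_2,E_2)$ are (vertex-disjoint copies of, possibly identical) graphs in $\mathcal{GAQ}_{n-1}$ and $M_1,M_2$ are edge-disjoint perfect matchings between $V_1$ and $V_2$; such graphs are $(2n-1)$-regular on $2^n$ vertices. Restricted generalized a-cubes: $\mathcal{RGAQ}_4=\{AQ_4\}$; for $n\geq 5$, $\mathcal{RGAQ}_n$ consists of all graphs obtained as in the definition of $\mathcal{GAQ}_n$ from $G_1,G_2\in\mathcal{GAQ}_{n-1}$ with the additional requirement that the edge set $M_1\cup M_2$ contains neither a 4-cycle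 nor a 6-cycle. For $F\subseteq V(G)\cup E(G)$, $G-F$ denotes $G$ with the vertices and edges of $F$ deleted. A fractional perfect matching of $G$ is $f:E(G)\to[0,1]$ with $\sum_{e\ni v}f(e)=1$ for every vertex $v$. A fractional strong matching preclusion (FSMP) set is $F\subseteq V(G)\cup E(G)$ with $G-F$ having no fractional perfect matching; $fsmp(G)$ is the minimum size of an FSMP set, and an FSMP set of that size is optimal. $G$ is fractional strongly maximally matched if $fsmp(G)=\delta(G)$, and fractional strongly super matched if in addition $G-F$ has an isolated vertex for every optimal FSMP set $F$. *)

theory Defs
  imports Complex_Main
begin

text \<open>Simple graphs: a vertex set together with a set of 2-element edges.\<close>
type_synonym 'a graph = "'a set \<times> 'a set set"

definition verts :: "'a graph \<Rightarrow> 'a set" where "verts G = fst G"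
definition edges :: "'a graph \<Rightarrow> 'a set set" where "edges G = snd G"

text \<open>Adjacency in the augmented cube on binary strings (bool lists);
  the first letter is the one prefixed in the recursive construction.\<close>
fun aq_adj :: "bool list \<Rightarrow> bool list \<Rightarrow> bool" where
  "aq_adj (a # u) (b # v) =
     (length u = length v \<and>
      (if a = b then aq_adj u v else (u = v \<or> list_all2 (\<noteq>) u v)))"
| "aq_adj _ _ = False"

definition AQ :: "nat \<Rightarrow> bool list graph" where
  "AQ n = ({xs. length xs = n},
           {{u, v} | u v. length u = n \<and> length v = n \<and> aq_adj u v})"

definition graph_iso :: "'a graph \<Rightarrow> 'b graph \<Rightarrow> bool" where
  "graph_iso G H \<longleftrightarrow> (\<exists>f. bij_betw f (verts G) (verts H) \<and> (\<lambda>e. f ` e) ` edges G = edges H)"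

definition perfect_matching_between :: "'a set \<Rightarrow> 'a set \<Rightarrow> 'a set set \<Rightarrow> bool" where
  "perfect_matching_between V1 V2 M \<longleftrightarrow>
     M \<subseteq> {{x, y} | x y. x \<in> V1 \<and> y \<in> V2} \<and> (\<forall>v \<in> V1 \<union> V2. \<exists>!e. e \<in> M \<and> v \<in> e)"

inductive gaq :: "nat \<Rightarrow> 'a graph \<Rightarrow> bool" where
  base: "graph_iso (AQ 4) G \<Longrightarrow> gaq 4 G"
| step: "\<lbrakk> n \<ge> 5; gaq (n - 1) (V1, E1); gaq (n - 1) (V2, E2); V1 \<inter> V2 = {};
           perfect_matching_between V1 V2 M1; perfect_matching_between V1 V2 M2; M1 \<inter> M2 = {} \<rbrakk>
         \<Longrightarrow> gaq n (V1 \<union> V2, E1 \<union> E2 \<union> M1 \<union> M2)"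

text \<open>A cycle of length k (k \<ge> 3) using only edges from F.\<close>
definition has_cycle_of_length :: "'a set set \<Rightarrow> nat \<Rightarrow> bool" where
  "has_cycle_of_length F k \<longleftrightarrow>
     (\<exists>vs. length vs = k \<and> distinct vs \<and> (\<forall>i < k. {vs ! i, vs ! ((i + 1) mod k)} \<in> F))"

definition rgaq :: "nat \<Rightarrow> 'a graph \<Rightarrow> bool" where
  "rgaq n G \<longleftrightarrow>
     (n = 4 \<and> graph_iso (AQ 4) G) \<or>
     (n \<ge> 5 \<and> (\<exists>V1 E1 V2 E2 M1 M2.
        G = (V1 \<union> V2, E1 \<union> E2 \<union> M1 \<union> M2) \<and>
        gaq (n - 1) (V1, E1) \<and> gaq (n - 1) (V2, E2) \<and> V1 \<inter> V2 = {} \<and>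
        perfect_matching_between V1 V2 M1 \<and> perfect_matching_between V1 V2 M2 \<and> M1 \<inter> M2 = {} \<and>
        \<not> has_cycle_of_length (M1 \<union> M2) 4 \<and> \<not> has_cycle_of_length (M1 \<union> M2) 6))"

definition delete :: "'a graph \<Rightarrow> 'a set \<Rightarrow> 'a set set \<Rightarrow> 'a graph" where
  "delete G FV FE = (verts G - FV, {e \<in> edges G. e \<inter> FV = {}} - FE)"

definition has_fractional_perfect_matching :: "'a graph \<Rightarrow> bool" where
  "has_fractional_perfect_matching G \<longleftrightarrow>
     (\<exists>f :: 'a set \<Rightarrow> real. (\<forall>e \<in> edges G. 0 \<le> f e \<and> f e \<le> 1) \<and>
        (\<forall>v \<in> verts G. (\<Sum>e \<in> {e \<in> edges G. v \<in> e}. f e) = 1))"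

definition fsmp_set :: "'a graph \<Rightarrow> 'a set \<Rightarrow> 'a set set \<Rightarrow> bool" where
  "fsmp_set G FV FE \<longleftrightarrow> FV \<subseteq> verts G \<and> FE \<subseteq> edges G \<and>
     \<not> has_fractional_perfect_matching (delete G FV FE)"

definition fsmp :: "'a graph \<Rightarrow> nat" where
  "fsmp G = (LEAST k. \<exists>FV FE. fsmp_set G FV FE \<and> card FV + card FE = k)"

definition optimal_fsmp_set :: "'a graph \<Rightarrow> 'a set \<Rightarrow> 'a set set \<Rightarrow> bool" where
  "optimal_fsmp_set G FV FE \<longleftrightarrow> fsmp_set G FV FE \<and> card FV + card FE = fsmp G"

definition degree :: "'a graph \<Rightarrow> 'a \<Rightarrow> nat" where
  "degree G v = card {e \<in> edges G. v \<in> e}"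

definition min_degree :: "'a graph \<Rightarrow> nat" where
  "min_degree G = Min (degree G ` verts G)"

definition has_isolated_vertex :: "'a graph \<Rightarrow> bool" where
  "has_isolated_vertex G \<longleftrightarrow> (\<exists>v \<in> verts G. \<forall>e \<in> edges G. v \<notin> e)"

definition frac_strongly_maximally_matched :: "'a graph \<Rightarrow> bool" where
  "frac_strongly_maximally_matched G \<longleftrightarrow> fsmp G = min_degree G"

definition frac_strongly_super_matched :: "'a graph \<Rightarrow> bool" where
  "frac_strongly_super_matched G \<longleftrightarrow> frac_strongly_maximally_matched G \<and>
     (\<forall>FV FE. optimal_fsmp_set G FV FE \<longrightarrow> has_isolated_vertex (delete G FV FE))"

end

theory Submission
  imports Defs
begin

text \<open>
  For a vertex set \<open>A\<close> let the excess of \<open>A\<close> be the number of vertices outside \<open>A\<close> adjacent to \<open>A\<close>, plus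
  the number of edges inside \<open>A\<close>, minus the size of \<open>A\<close>. By the
  marriage theorem on the bipartite double cover, a graph without fractional perfect matching has an independent set \<open>A\<close> with fewer neighbours than
  elements. If the graph is \<open>G - F\<close>, then \<open>F\<close> must contain all edges of \<open>G\<close> inside \<open>A\<close> and must cut off
  all but \<open>|A| - 1\<close> of the outside neighbours, hence the excess of \<open>A\<close> in \<open>G\<close> is less than \<open>|F|\<close>.

  It remains to see that every nonempty set in a generalized augmented cube has excess at least
  \<open>2n - 2\<close>. The excess is superadditive over the two halves, and a set within one half gains at least
  the two cross neighbours of any of its vertices, so the bound follows by induction from \<open>AQ\<^sub>4\<close>,
  which is checked by enumeration.
  Equality forces the set into one half with exactly two cross neighbours; two distinct vertices of
  the set would then span a 4-cycle of matching edges, so in the restricted case the set is a single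
  vertex, which is isolated in \<open>G - F\<close>.
\<close>

section \<open>Hall's marriage theorem\<close>

text \<open>Induction on the size of \<open>V\<close>, split on whether some nonempty proper subset
  meets Hall's condition with equality. A tight subset is matched separately from its complement;
  without one, a single vertex can be matched to any of its candidates.\<close>

theorem hall_marriage:
  assumes "finite V" and "\<And>v. v \<in> V \<Longrightarrow> finite (N v)"
    and "\<And>S. S \<subseteq> V \<Longrightarrow> card S \<le> card (\<Union>(N ` S))"
  shows "\<exists>\<sigma>. inj_on \<sigma> V \<and> (\<forall>v\<in>V. \<sigma> v \<in> N v)"
  using assms
proof (induction "card V" arbitrary: V N rule: less_induct)
  case less
  note fin = less.prems(1) and finN = less.prems(2) and hall = less.prems(3)
  have finU: "finite (\<Union>(N ` S))" if "S \<subseteq> V" for S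
    using that fin finN by (meson finite_UN_I finite_subset subsetD)
  show ?case
  proof (cases "V = {}")
    case False
    then obtain x where x: "x \<in> V" by blast
    show ?thesis
    proof (cases "\<exists>S. S \<subset> V \<and> S \<noteq> {} \<and> card S = card (\<Union>(N ` S))")
      case True
      then obtain S where S: "S \<subset> V" "S \<noteq> {}" "card S = card (\<Union>(N ` S))" by blast
      have finS: "finite S" using S(1) fin by (meson finite_subset psubset_imp_subset)
      have "\<exists>\<sigma>. inj_on \<sigma> S \<and> (\<forall>v\<in>S. \<sigma> v \<in> N v)"
        using less.hyps[of S N] S(1) fin finS finN hall by (meson psubset_card_mono psubset_imp_subset subsetD subset_trans)
      then obtain \<sigma> where \<sigma>: "inj_on \<sigma> S" "\<And>v. v \<in> S \<Longrightarrow> \<sigma> v \<in> N v" by blast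
      let ?U = "\<Union>(N ` S)"
      let ?N = "\<lambda>v. N v - ?U"
      \<comment> \<open>Withdrawing the candidates of \<open>S\<close> costs exactly
        \<open>card S\<close> of them, so the condition for \<open>S \<union> T\<close> leaves
        enough for \<open>T\<close>.\<close>
      have hall': "card T \<le> card (\<Union>(?N ` T))" if T: "T \<subseteq> V - S" for T
      proof -
        have finT: "finite T" using T fin by (meson finite_Diff finite_subset)
        have sub: "S \<union> T \<subseteq> V" using S(1) T by blast
        have "card S + card T = card (S \<union> T)"
          using T finS finT by (subst card_Un_disjoint) auto
        also have "\<dots> \<le> card (\<Union>(N ` (S \<union> T)))" by (rule hall[OF sub])
        also have "\<Union>(N ` (S \<union> T)) = ?U \<union> \<Union>(?N ` T)" by blast
        also have "card \<dots> \<le> card ?U + card (\<Union>(?N ` T))" by (rule card_Un_le)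
        finally show ?thesis using S(3) by simp
      qed
      have "card (V - S) < card V"
        using S(1,2) fin by (intro psubset_card_mono) auto
      then obtain \<tau> where \<tau>: "inj_on \<tau> (V - S)" "\<And>v. v \<in> V - S \<Longrightarrow> \<tau> v \<in> ?N v"
        using less.hyps[of "V - S" ?N] fin finN hall' by (metis Diff_iff finite_Diff)
      let ?\<rho> = "\<lambda>v. if v \<in> S then \<sigma> v else \<tau> v"
      have "inj_on ?\<rho> V"
      proof (rule inj_onI)
        fix u v assume uv: "u \<in> V" "v \<in> V" "?\<rho> u = ?\<rho> v"
        have mixed: "\<sigma> a \<noteq> \<tau> b" if "a \<in> S" "b \<in> V - S" for a b
          using \<sigma>(2)[OF that(1)] \<tau>(2)[OF that(2)] that(1) by auto
        show "u = v"
          using uv \<sigma>(1) \<tau>(1) mixed[of u v] mixed[of v u]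
          by (auto split: if_splits dest: inj_onD)
      qed
      moreover have "\<forall>v\<in>V. ?\<rho> v \<in> N v" using \<sigma>(2) \<tau>(2) by auto
      ultimately show ?thesis by blast
    next
      case False
      have "card {x} \<le> card (\<Union>(N ` {x}))" using x by (intro hall) auto
      then have "N x \<noteq> {}" by auto
      then obtain y where y: "y \<in> N x" by blast
      let ?N = "\<lambda>v. N v - {y}"
      \<comment> \<open>No nonempty proper subset is tight, so each has a candidate to spare and
        survives the loss of \<open>y\<close>.\<close>
      have hall': "card T \<le> card (\<Union>(?N ` T))" if T: "T \<subseteq> V - {x}" for T
      proof (cases "T = {}")
        case nonempty: False
        have TV: "T \<subset> V" using T x by blast
        have "card T < card (\<Union>(N ` T))"
          using False TV nonempty hall[of T] by (metis le_neq_implies_less psubset_imp_subset)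
        moreover have "\<Union>(?N ` T) = \<Union>(N ` T) - {y}" by blast
        moreover have "card (\<Union>(N ` T)) \<le> Suc (card (\<Union>(N ` T) - {y}))"
          by (metis card_Suc_Diff1 card_Diff_singleton_if finU TV psubset_imp_subset le_SucI order_refl)
        ultimately show ?thesis by simp
      qed simp
      have "card (V - {x}) < card V" using x fin by (meson card_Diff1_less)
      then obtain \<tau> where \<tau>: "inj_on \<tau> (V - {x})" "\<And>v. v \<in> V - {x} \<Longrightarrow> \<tau> v \<in> ?N v"
        using less.hyps[of "V - {x}" ?N] fin finN hall' by (metis Diff_iff finite_Diff)
      have "inj_on (\<tau>(x := y)) V"
      proof (rule inj_onI)
        fix u v assume uv: "u \<in> V" "v \<in> V" "(\<tau>(x := y)) u = (\<tau>(x := y)) v"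
        show "u = v"
          using uv \<tau>(1) \<tau>(2)[of u] \<tau>(2)[of v] by (auto split: if_splits dest: inj_onD)
      qed
      moreover have "\<forall>v\<in>V. (\<tau>(x := y)) v \<in> N v" using \<tau>(2) y by auto
      ultimately show ?thesis by blast
    qed
  qed simp
qed

section \<open>Fractional perfect matchings and independent Hall violators\<close>

definition simple_graph :: "'a graph \<Rightarrow> bool" where
  "simple_graph G \<longleftrightarrow> finite (verts G) \<and>
     (\<forall>e\<in>edges G. \<exists>u\<in>verts G. \<exists>v\<in>verts G. u \<noteq> v \<and> e = {u, v})"

definition neighbours :: "'a graph \<Rightarrow> 'a set \<Rightarrow> 'a set" where
  "neighbours G A = {v \<in> verts G. \<exists>u\<in>A. {u, v} \<in> edges G}"

lemma simple_graph_finite_edges: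
  assumes "simple_graph G" shows "finite (edges G)"
proof -
  have "edges G \<subseteq> Pow (verts G)" using assms by (fastforce simp: simple_graph_def)
  then show ?thesis using assms finite_subset[of "edges G" "Pow (verts G)"] by (simp add: simple_graph_def)
qed

lemma simple_graph_edgeE:
  assumes "simple_graph G" "e \<in> edges G"
  obtains u v where "u \<in> verts G" "v \<in> verts G" "u \<noteq> v" "e = {u, v}"
  using assms unfolding simple_graph_def by meson

lemma simple_graph_edgeD:
  assumes "simple_graph G" "{u, v} \<in> edges G"
  shows "u \<in> verts G" "v \<in> verts G" "u \<noteq> v"
proof -
  obtain a b where "a \<in> verts G" "b \<in> verts G" "a \<noteq> b" "{u, v} = {a, b}"
    using simple_graph_edgeE[OF assms] by metis
  then show "u \<in> verts G" "v \<in> verts G" "u \<noteq> v" by (auto simp: doubleton_eq_iff)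
qed

text \<open>On a finite vertex set \<open>\<sigma>\<close> is a permutation. Every vertex puts
  weight 1/2 on its edge \<open>{v, \<sigma> v}\<close>, so each vertex is covered with 1/2 by its
  own edge and 1/2 by that of its preimage.\<close>

lemma fractional_perfect_matching_of_injection:
  assumes G: "simple_graph G" and inj: "inj_on \<sigma> (verts G)"
    and edge: "\<And>v. v \<in> verts G \<Longrightarrow> {v, \<sigma> v} \<in> edges G"
  shows "has_fractional_perfect_matching G"
proof -
  let ?V = "verts G"
  have finV: "finite ?V" using G by (simp add: simple_graph_def)
  have maps: "\<sigma> ` ?V \<subseteq> ?V" using simple_graph_edgeD(2)[OF G edge] by blast
  have onto: "\<sigma> ` ?V = ?V" by (rule endo_inj_surj[OF finV maps inj])
  let ?F = "\<lambda>e. {v \<in> ?V. {v, \<sigma> v} = e}"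
  \<comment> \<open>An edge whose ends are swapped by \<open>\<sigma>\<close> is chosen twice and
    gets weight 1.\<close>
  define f where "f e = real (card (?F e)) / 2" for e
  have "0 \<le> f e \<and> f e \<le> 1" if e: "e \<in> edges G" for e
  proof -
    obtain a b where ab: "e = {a, b}" using simple_graph_edgeE[OF G e] by metis
    have "?F e \<subseteq> {a, b}" unfolding ab by (auto simp: doubleton_eq_iff)
    then have "card (?F e) \<le> card {a, b}" by (intro card_mono) auto
    also have "\<dots> \<le> 2" by (simp add: card_insert_if)
    finally show ?thesis by (simp add: f_def)
  qed
  moreover have "(\<Sum>e \<in> {e \<in> edges G. w \<in> e}. f e) = 1" if w: "w \<in> ?V" for w
  proof -
    have "w \<in> \<sigma> ` ?V" using w by (simp add: onto)
    then obtain u where u: "u \<in> ?V" "\<sigma> u = w" by blast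
    have "u \<noteq> w" using simple_graph_edgeD(3)[OF G edge[OF u(1)]] u(2) by simp
    let ?E = "{e \<in> edges G. w \<in> e}"
    have finE: "finite ?E" using simple_graph_finite_edges[OF G] by simp
    have "{v \<in> ?V. w \<in> {v, \<sigma> v}} = {u, w}"
      using u w inj by (auto dest: inj_onD)
    moreover have "{v \<in> ?V. w \<in> {v, \<sigma> v}} = (\<Union>e\<in>?E. ?F e)" using edge by auto
    ultimately have "(\<Union>e\<in>?E. ?F e) = {u, w}" by argo
    then have "card (\<Union>e\<in>?E. ?F e) = 2" using \<open>u \<noteq> w\<close> by simp
    moreover have "card (\<Union>e\<in>?E. ?F e) = (\<Sum>e\<in>?E. card (?F e))"
      using finE finV by (intro card_UN_disjoint) auto
    ultimately have "(\<Sum>e\<in>?E. card (?F e)) = 2" by simp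
    then have "real (\<Sum>e\<in>?E. card (?F e)) = 2" by simp
    then have "(\<Sum>e\<in>?E. real (card (?F e))) = 2" by (simp only: of_nat_sum)
    then show ?thesis unfolding f_def by (simp flip: sum_divide_distrib)
  qed
  ultimately show ?thesis unfolding has_fractional_perfect_matching_def by blast
qed

text \<open>Hall's theorem, applied to neighbourhoods, yields a violator \<open>S\<close>. Dropping
  the vertices of \<open>S\<close> that have a neighbour in \<open>S\<close> makes it independent;
  no remaining vertex has a neighbour in \<open>S\<close>, so the set and its neighbourhood both
  shrink by at least \<open>card (S \<inter> neighbours G S)\<close>, the set by exactly that
  much.\<close>

lemma independent_hall_violator:
  assumes G: "simple_graph G" and no: "\<not> has_fractional_perfect_matching G"
  obtains A where "A \<subseteq> verts G" "A \<inter> neighbours G A = {}" "card (neighbours G A) < card A"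
proof -
  let ?V = "verts G"
  have finV: "finite ?V" using G by (simp add: simple_graph_def)
  have nbr: "neighbours G S = (\<Union>v\<in>S. {w \<in> ?V. {v, w} \<in> edges G})" for S
    by (auto simp: neighbours_def)
  have "\<exists>S\<subseteq>?V. card (neighbours G S) < card S"
  proof (rule ccontr)
    assume "\<not> ?thesis"
    then have "\<exists>\<sigma>. inj_on \<sigma> ?V \<and> (\<forall>v\<in>?V. \<sigma> v \<in> {w \<in> ?V. {v, w} \<in> edges G})"
      using finV by (intro hall_marriage) (auto simp: nbr not_less)
    with no show False using fractional_perfect_matching_of_injection[OF G] by auto
  qed
  then obtain S where S: "S \<subseteq> ?V" "card (neighbours G S) < card S" by blast
  have fins: "finite S" "finite (neighbours G S)"
    using S(1) finV by (auto simp: neighbours_def intro: finite_subset)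
  define A where "A = S - neighbours G S"
  have AV: "A \<subseteq> ?V" using S(1) by (auto simp: A_def)
  have NA: "neighbours G A \<subseteq> neighbours G S - S"
  proof
    fix w assume w: "w \<in> neighbours G A"
    then obtain u where u: "u \<in> A" "{u, w} \<in> edges G" "w \<in> ?V" by (auto simp: neighbours_def)
    have "{w, u} \<in> edges G" using u(2) by (simp add: insert_commute)
    have "w \<notin> S"
    proof
      assume "w \<in> S"
      then have "u \<in> neighbours G S"
        using u AV \<open>{w, u} \<in> edges G\<close> unfolding neighbours_def by blast
      then show False using u(1) by (simp add: A_def)
    qed
    then show "w \<in> neighbours G S - S" using u by (auto simp: A_def neighbours_def)
  qed
  have "card (neighbours G A) \<le> card (neighbours G S - S)" using NA fins by (intro card_mono) auto
  also have "\<dots> = card (neighbours G S) - card (S \<inter> neighbours G S)"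
    using fins by (metis card_Diff_subset_Int finite_Int inf_commute)
  \<comment> \<open>Truncated subtraction stays strictly monotone here, because the intersection is
    contained in \<open>neighbours G S\<close>.\<close>
  also have "\<dots> < card S - card (S \<inter> neighbours G S)"
    using S(2) fins by (meson card_mono diff_less_mono inf_le2)
  also have "\<dots> = card A"
    using fins by (metis A_def card_Diff_subset_Int finite_Int)
  finally have "card (neighbours G A) < card A" .
  moreover have "A \<inter> neighbours G A = {}" using NA by (auto simp: A_def)
  ultimately show thesis using that AV by blast
qed

section \<open>The excess of a vertex set\<close>

text \<open>\<open>W\<close> is independent of \<open>E\<close>, so that the edges of a whole graph
  can be examined within one half or from one half into the other.\<close>

definition boundary :: "'a set set \<Rightarrow> 'a set \<Rightarrow> 'a set \<Rightarrow> 'a set" where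
  "boundary E W A = {v \<in> W - A. \<exists>u\<in>A. {u, v} \<in> E}"

definition inner :: "'a set set \<Rightarrow> 'a set \<Rightarrow> 'a set set" where
  "inner E A = {e \<in> E. e \<subseteq> A}"

definition excess :: "'a set set \<Rightarrow> 'a set \<Rightarrow> 'a set \<Rightarrow> int" where
  "excess E W A = int (card (boundary E W A)) + int (card (inner E A)) - int (card A)"

text \<open>Take an independent Hall violator \<open>A\<close> of the damaged graph. A boundary
  vertex is deleted, or still a neighbour of \<open>A\<close>, or has lost an edge to
  \<open>A\<close>; fewer than \<open>card A\<close> are of the second kind. Together with the
  deleted inner edges this bounds the excess. For a singleton, no neighbour is left at all.\<close>

lemma fsmp_set_excess:
  assumes G: "simple_graph G" and F: "fsmp_set G FV FE"
  obtains A where "A \<subseteq> verts G" "A \<noteq> {}" "excess (edges G) (verts G) A < int (card FV + card FE)"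
    "card A = 1 \<Longrightarrow> has_isolated_vertex (delete G FV FE)"
proof -
  let ?H = "delete G FV FE" and ?E = "edges G" and ?V = "verts G"
  have finV: "finite ?V" using G by (simp add: simple_graph_def)
  have F': "FV \<subseteq> ?V" "FE \<subseteq> ?E" "\<not> has_fractional_perfect_matching ?H"
    using F by (auto simp: fsmp_set_def)
  have finF: "finite FV" "finite FE"
    using F'(1,2) finV simple_graph_finite_edges[OF G] finite_subset by blast+
  have vH: "verts ?H = ?V - FV" and eH: "edges ?H = {e \<in> ?E. e \<inter> FV = {}} - FE"
    by (auto simp: delete_def verts_def edges_def)
  have H: "simple_graph ?H"
    using G unfolding simple_graph_def vH eH by (fastforce simp: finite_Diff)
  obtain A where A: "A \<subseteq> ?V - FV" "A \<inter> neighbours ?H A = {}" "card (neighbours ?H A) < card A"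
    using independent_hall_violator[OF H F'(3)] unfolding vH by blast
  have AV: "A \<subseteq> ?V" using A(1) by blast
  let ?B = "boundary ?E ?V A" and ?I = "inner ?E A"
  \<comment> \<open>No vertex of \<open>A\<close> is deleted and \<open>A\<close> is independent
    afterwards, so its inner edges must be deleted as edges.\<close>
  have I: "?I \<subseteq> FE"
  proof
    fix e assume e: "e \<in> ?I"
    then have "e \<in> ?E" by (simp add: inner_def)
    then obtain u v where uv: "e = {u, v}" "u \<noteq> v" using simple_graph_edgeE[OF G] by metis
    have mem: "u \<in> A" "v \<in> A" "e \<in> ?E" using e unfolding uv(1) inner_def by blast+
    show "e \<in> FE"
    proof (rule ccontr)
      assume "e \<notin> FE"
      then have "v \<in> neighbours ?H A"
        using mem A(1) uv unfolding neighbours_def vH eH by blast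
      then show False using mem A(2) by blast
    qed
  qed
  \<comment> \<open>Each of these vertices accounts for a deleted edge of its own: \<open>p\<close>
    picks the end in \<open>A\<close>, and the other end, outside \<open>A\<close>, determines the
    vertex.\<close>
  let ?R = "?B - FV - neighbours ?H A"
  have "\<exists>u. \<forall>w\<in>?R. u w \<in> A \<and> {u w, w} \<in> ?E"
    by (intro bchoice) (auto simp: boundary_def)
  then obtain p where p: "\<And>w. w \<in> ?R \<Longrightarrow> p w \<in> A \<and> {p w, w} \<in> ?E" by blast
  have R: "(\<lambda>w. {p w, w}) ` ?R \<subseteq> FE - ?I"
  proof safe
    fix w assume w: "w \<in> ?B" "w \<notin> FV" "w \<notin> neighbours ?H A"
    then have pw: "p w \<in> A" "{p w, w} \<in> ?E" using p by auto
    show "{p w, w} \<in> FE"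
    proof (rule ccontr)
      assume "{p w, w} \<notin> FE"
      then have "w \<in> neighbours ?H A"
        using w pw A(1) unfolding neighbours_def vH eH boundary_def by blast
      then show False using w by blast
    qed
    assume "{p w, w} \<in> ?I"
    then show False using w by (auto simp: inner_def boundary_def)
  qed
  have "inj_on (\<lambda>w. {p w, w}) ?R"
  proof (rule inj_onI)
    fix w z assume wz: "w \<in> ?R" "z \<in> ?R" "{p w, w} = {p z, z}"
    then have "p w \<in> A" "p z \<in> A" "w \<notin> A" "z \<notin> A" using p by (auto simp: boundary_def)
    then show "w = z" using wz(3) by (auto simp: doubleton_eq_iff)
  qed
  then have "card ?R \<le> card (FE - ?I)"
    using R finF by (intro card_inj_on_le[where f = "\<lambda>w. {p w, w}"]) auto
  also have "\<dots> = card FE - card ?I"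
    using I finF by (intro card_Diff_subset) (auto intro: finite_subset)
  finally have cR: "card ?R + card ?I \<le> card FE"
    using I finF card_mono[of FE ?I] by simp
  have finN: "finite (neighbours ?H A)" using finV by (simp add: neighbours_def vH)
  have finB: "finite ?B" using finV by (simp add: boundary_def)
  have "card ?B \<le> card (FV \<union> neighbours ?H A \<union> ?R)"
    using finF finN finB by (intro card_mono) auto
  also have "\<dots> \<le> card FV + card (neighbours ?H A) + card ?R"
    by (meson add_le_mono card_Un_le order_trans order_refl)
  finally have "excess ?E ?V A < int (card FV + card FE)"
    using cR A(3) by (simp add: excess_def)
  moreover have "has_isolated_vertex ?H" if one: "card A = 1"
  proof -
    obtain v where v: "A = {v}" using one by (meson card_1_singletonE)
    have "neighbours ?H A = {}" using A(3) one finN by simp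
    then have none: "{v, w} \<notin> edges ?H" for w
      using simple_graph_edgeD(2)[OF H, of v w] unfolding v neighbours_def by blast
    have "v \<notin> e" if e: "e \<in> edges ?H" for e
    proof
      assume ve: "v \<in> e"
      obtain a b where ab: "e = {a, b}" using simple_graph_edgeE[OF H e] by metis
      then show False using ve e none[of a] none[of b] by (auto simp: insert_commute)
    qed
    then show ?thesis using A(1) unfolding has_isolated_vertex_def v vH by blast
  qed
  moreover have "A \<noteq> {}" using A(3) by auto
  ultimately show thesis using that AV by blast
qed

text \<open>Only edges inside \<open>W\<close> enter the excess. Within one half, the edges of the
  joined graph may thus be exchanged for those of the half.\<close>

lemma excess_cong:
  assumes "A \<subseteq> W" and "\<And>e. e \<subseteq> W \<Longrightarrow> e \<in> E \<longleftrightarrow> e \<in> E'"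
  shows "excess E W A = excess E' W A"
proof -
  have "{u, v} \<in> E \<longleftrightarrow> {u, v} \<in> E'" if "u \<in> A" "v \<in> W" for u v
    using that assms(1) by (intro assms(2)) auto
  then have "boundary E W A = boundary E' W A" unfolding boundary_def by blast
  moreover have "inner E A = inner E' A"
    unfolding inner_def using assms by (meson order_trans)
  ultimately show ?thesis by (simp add: excess_def)
qed

text \<open>Boundary vertices and inner edges of the parts remain such for the union, and none is
  counted twice: the halves are disjoint and edges are nonempty. Edges between the halves can only
  add inner edges or boundary vertices.\<close>

lemma excess_superadditive:
  assumes fin: "finite W" "finite E" and W: "W = W1 \<union> W2" "W1 \<inter> W2 = {}"
    and A: "A1 \<subseteq> W1" "A2 \<subseteq> W2" and E: "{} \<notin> E"
  shows "excess E W1 A1 + excess E W2 A2 \<le> excess E W (A1 \<union> A2)"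
proof -
  have finW: "finite W1" "finite W2" using fin(1) W(1) by auto
  have "card (boundary E W1 A1) + card (boundary E W2 A2) = card (boundary E W1 A1 \<union> boundary E W2 A2)"
    using finW W(2) by (subst card_Un_disjoint) (auto simp: boundary_def)
  also have "\<dots> \<le> card (boundary E W (A1 \<union> A2))"
    using fin W A by (intro card_mono) (auto simp: boundary_def)
  finally have 1: "card (boundary E W1 A1) + card (boundary E W2 A2) \<le> card (boundary E W (A1 \<union> A2))" .
  have disj: "e \<notin> inner E A2" if "e \<in> inner E A1" for e
  proof
    assume "e \<in> inner E A2"
    then have "e \<subseteq> W1 \<inter> W2" using that A by (auto simp: inner_def)
    then have "e = {}" using W(2) by simp
    then show False using that E by (simp add: inner_def)
  qed
  have "card (inner E A1) + card (inner E A2) = card (inner E A1 \<union> inner E A2)"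
    using fin(2) disj by (subst card_Un_disjoint) (auto simp: inner_def)
  also have "\<dots> \<le> card (inner E (A1 \<union> A2))"
    using fin(2) by (intro card_mono) (auto simp: inner_def)
  finally have 2: "card (inner E A1) + card (inner E A2) \<le> card (inner E (A1 \<union> A2))" .
  have "card (A1 \<union> A2) = card A1 + card A2"
    using finW A W(2) by (intro card_Un_disjoint) (auto intro: finite_subset)
  then show ?thesis using 1 2 by (simp add: excess_def)
qed

text \<open>Inner edges and cardinality do not depend on the surrounding set; only the boundary
  splits.\<close>

lemma excess_enlarge:
  assumes fin: "finite W" and W: "W = W1 \<union> W2" "W1 \<inter> W2 = {}" and A: "A \<subseteq> W1"
  shows "excess E W A = excess E W1 A + int (card (boundary E W2 A))"
proof -
  have "boundary E W A = boundary E W1 A \<union> boundary E W2 A"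
    unfolding W(1) boundary_def by blast
  moreover have "card (boundary E W1 A \<union> boundary E W2 A) = card (boundary E W1 A) + card (boundary E W2 A)"
    using fin W by (intro card_Un_disjoint) (auto simp: boundary_def)
  ultimately show ?thesis by (simp add: excess_def)
qed

section \<open>Two graphs joined by two perfect matchings\<close>

lemma perfect_matching_between_commute:
  assumes "perfect_matching_between V1 V2 M" shows "perfect_matching_between V2 V1 M"
proof -
  have "{{x, y} | x y. x \<in> V1 \<and> y \<in> V2} = {{x, y} | x y. x \<in> V2 \<and> y \<in> V1}"
    by (auto simp: insert_commute)
  then show ?thesis using assms unfolding perfect_matching_between_def by (simp add: Un_commute)
qed

lemma perfect_matching_edgeE:
  assumes "perfect_matching_between V1 V2 M" "e \<in> M"
  obtains x y where "x \<in> V1" "y \<in> V2" "e = {x, y}"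
  using assms unfolding perfect_matching_between_def by blast

lemma perfect_matching_partner:
  assumes M: "perfect_matching_between V1 V2 M" and v: "v \<in> V1" and disj: "V1 \<inter> V2 = {}"
  obtains y where "y \<in> V2" "{e \<in> M. v \<in> e} = {{v, y}}"
proof -
  have "\<exists>!e. e \<in> M \<and> v \<in> e" using M v by (simp add: perfect_matching_between_def)
  then obtain e where e: "e \<in> M" "v \<in> e" "\<And>e'. e' \<in> M \<Longrightarrow> v \<in> e' \<Longrightarrow> e' = e" by blast
  obtain x y where xy: "x \<in> V1" "y \<in> V2" "e = {x, y}" using perfect_matching_edgeE[OF M e(1)] .
  have "x = v" using e(2) xy v disj by auto
  moreover have "{e' \<in> M. v \<in> e'} = {e}" using e by blast
  ultimately have "{e \<in> M. v \<in> e} = {{v, y}}" using xy(3) by simp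
  then show thesis using that xy(2) by blast
qed

locale joined_graphs =
  fixes V1 V2 :: "'a set" and E1 E2 M1 M2 :: "'a set set"
  assumes simple1: "simple_graph (V1, E1)" and simple2: "simple_graph (V2, E2)"
    and disj: "V1 \<inter> V2 = {}"
    and M1: "perfect_matching_between V1 V2 M1" and M2: "perfect_matching_between V1 V2 M2"
    and M12: "M1 \<inter> M2 = {}"
begin

definition "V = V1 \<union> V2"
definition "E = E1 \<union> E2 \<union> M1 \<union> M2"

text \<open>By this symmetry every fact shown for \<open>V1\<close> transfers to \<open>V2\<close>;
  the two equations that follow restore \<open>V\<close> and \<open>E\<close> after the
  exchange.\<close>

lemma swap: "joined_graphs V2 V1 E2 E1 M1 M2"
  using simple1 simple2 disj M1 M2 M12 by (simp add: joined_graphs_def perfect_matching_between_commute Int_commute)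

lemma swap_V: "joined_graphs.V V2 V1 = V"
  using joined_graphs.V_def[OF swap] by (auto simp: V_def)

lemma swap_E: "joined_graphs.E E2 E1 M1 M2 = E"
  using joined_graphs.E_def[OF swap] by (auto simp: E_def)

lemma finite_V: "finite V1" "finite V2" "finite V"
  using simple1 simple2 by (auto simp: simple_graph_def verts_def V_def)

lemma simple: "simple_graph (V, E)"
proof -
  have "\<exists>u\<in>V. \<exists>v\<in>V. u \<noteq> v \<and> e = {u, v}" if e: "e \<in> E" for e
  proof -
    consider "e \<in> E1" | "e \<in> E2" | M where "perfect_matching_between V1 V2 M" "e \<in> M"
      using e M1 M2 unfolding E_def by blast
    then show ?thesis
    proof cases
      case 1
      then have "\<exists>u\<in>V1. \<exists>v\<in>V1. u \<noteq> v \<and> e = {u, v}"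
        using simple1 by (simp add: simple_graph_def edges_def verts_def)
      then show ?thesis unfolding V_def by blast
    next
      case 2
      then have "\<exists>u\<in>V2. \<exists>v\<in>V2. u \<noteq> v \<and> e = {u, v}"
        using simple2 by (simp add: simple_graph_def edges_def verts_def)
      then show ?thesis unfolding V_def by blast
    next
      case 3
      obtain x y where xy: "x \<in> V1" "y \<in> V2" "e = {x, y}" using perfect_matching_edgeE[OF 3] .
      moreover have "x \<noteq> y" using xy disj by blast
      ultimately show ?thesis by (auto simp: V_def)
    qed
  qed
  then show ?thesis using finite_V by (simp add: simple_graph_def verts_def edges_def)
qed

lemma finite_E: "finite E"
  using simple_graph_finite_edges[OF simple] by (simp add: edges_def)

lemma empty_notin_E: "{} \<notin> E"
  using simple_graph_edgeE[OF simple, of "{}"] by (auto simp: edges_def)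

lemma E1_subset: "e \<in> E1 \<Longrightarrow> e \<subseteq> V1"
  using simple_graph_edgeE[OF simple1, of e] by (auto simp: edges_def verts_def)

lemma E1_nonempty: "e \<in> E1 \<Longrightarrow> e \<noteq> {}"
  using simple_graph_edgeE[OF simple1, of e] by (auto simp: edges_def verts_def)

lemma matching_meets_V2: "e \<in> M1 \<union> M2 \<Longrightarrow> e \<inter> V2 \<noteq> {}"
  using perfect_matching_edgeE[OF M1, of e] perfect_matching_edgeE[OF M2, of e] by auto

text \<open>Matching edges reach into \<open>V2\<close>, and edges of \<open>E2\<close> are nonempty
  subsets of \<open>V2\<close>, so neither fits into \<open>V1\<close>.\<close>

lemma induced1:
  assumes "e \<subseteq> V1" shows "e \<in> E \<longleftrightarrow> e \<in> E1"
proof -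
  have "e \<inter> V2 = {}" using assms disj by blast
  moreover have "e \<notin> E2"
    using joined_graphs.E1_subset[OF swap, of e] joined_graphs.E1_nonempty[OF swap, of e] assms disj by blast
  ultimately show ?thesis using matching_meets_V2[of e] by (auto simp: E_def)
qed

lemma partners:
  assumes v: "v \<in> V1"
  obtains y z where "y \<in> V2" "z \<in> V2" "y \<noteq> z" "{v, y} \<in> M1" "{v, z} \<in> M2"
    "{e \<in> M1 \<union> M2. v \<in> e} = {{v, y}, {v, z}}"
proof -
  obtain y where y: "y \<in> V2" "{e \<in> M1. v \<in> e} = {{v, y}}" using perfect_matching_partner[OF M1 v disj] .
  obtain z where z: "z \<in> V2" "{e \<in> M2. v \<in> e} = {{v, z}}" using perfect_matching_partner[OF M2 v disj] .
  have yz: "{v, y} \<in> M1" "{v, z} \<in> M2" using y(2) z(2) by blast+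
  then have "y \<noteq> z" using M12 by auto
  moreover have "{e \<in> M1 \<union> M2. v \<in> e} = {{v, y}, {v, z}}" using y(2) z(2) by auto
  ultimately show thesis using that y(1) z(1) yz by blast
qed

text \<open>The matchings are edge-disjoint, so the two partners of \<open>v\<close> differ and
  contribute two new edges.\<close>

lemma degree1:
  assumes v: "v \<in> V1" shows "degree (V, E) v = degree (V1, E1) v + 2"
proof -
  obtain y z where yz: "y \<in> V2" "z \<in> V2" "y \<noteq> z" "{e \<in> M1 \<union> M2. v \<in> e} = {{v, y}, {v, z}}"
    using partners[OF v] by metis
  have "v \<notin> e" if "e \<in> E2" for e
    using joined_graphs.E1_subset[OF swap that] v disj by blast
  then have "{e \<in> E. v \<in> e} = {e \<in> E1. v \<in> e} \<union> {e \<in> M1 \<union> M2. v \<in> e}"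
    by (auto simp: E_def)
  then have *: "{e \<in> E. v \<in> e} = {e \<in> E1. v \<in> e} \<union> {{v, y}, {v, z}}" by (simp only: yz(4))
  have "{v, y} \<notin> E1" "{v, z} \<notin> E1" using E1_subset yz disj by auto
  then have "card ({e \<in> E1. v \<in> e} \<union> {{v, y}, {v, z}}) = card {e \<in> E1. v \<in> e} + card {{v, y}, {v, z}}"
    using simple_graph_finite_edges[OF simple1] by (intro card_Un_disjoint) (auto simp: edges_def)
  moreover have "card {{v, y}, {v, z}} = 2" using yz(3) by (auto simp: doubleton_eq_iff)
  ultimately show ?thesis by (simp add: degree_def edges_def *)
qed

lemma two_cross_neighbours:
  assumes "A \<subseteq> V1" "v \<in> A"
  obtains y z where "y \<noteq> z" "{v, y} \<in> M1" "{v, z} \<in> M2" "{y, z} \<subseteq> boundary E V2 A"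
proof -
  have v: "v \<in> V1" using assms by blast
  obtain y z where yz: "y \<in> V2" "z \<in> V2" "y \<noteq> z" "{v, y} \<in> M1" "{v, z} \<in> M2"
    using partners[OF v] by metis
  have "{v, y} \<in> E" "{v, z} \<in> E" using yz by (auto simp: E_def)
  then have "{y, z} \<subseteq> boundary E V2 A"
    using yz assms disj unfolding boundary_def by blast
  then show thesis using that yz by blast
qed

lemma finite_boundary: "finite (boundary E V2 A)"
  using finite_V by (simp add: boundary_def)

lemma excess_one_side:
  assumes A: "A \<subseteq> V1" "A \<noteq> {}"
  shows "excess E V A = excess E1 V1 A + int (card (boundary E V2 A))" "2 \<le> card (boundary E V2 A)"
proof -
  show "excess E V A = excess E1 V1 A + int (card (boundary E V2 A))"
    using excess_enlarge[OF finite_V(3) V_def disj A(1), of E] excess_cong[OF A(1) induced1] by simp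
  obtain v where "v \<in> A" using A(2) by blast
  then obtain y z where yz: "y \<noteq> z" "{y, z} \<subseteq> boundary E V2 A"
    using two_cross_neighbours[OF A(1)] by metis
  then show "2 \<le> card (boundary E V2 A)"
    using card_mono[OF finite_boundary yz(2)] by simp
qed

lemma excess_both_sides:
  assumes "A1 \<subseteq> V1" "A2 \<subseteq> V2"
  shows "excess E1 V1 A1 + excess E2 V2 A2 \<le> excess E V (A1 \<union> A2)"
proof -
  have "excess E V2 A2 = excess E2 V2 A2"
    using excess_cong[OF assms(2) joined_graphs.induced1[OF swap, unfolded swap_E]] by simp
  then show ?thesis
    using excess_superadditive[OF finite_V(3) finite_E V_def disj assms empty_notin_E]
      excess_cong[OF assms(1) induced1] by simp
qed

text \<open>Both \<open>a\<close> and \<open>b\<close> have two distinct cross neighbours in a set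
  of at most two vertices, hence the same pair, which closes a 4-cycle.\<close>

lemma four_cycle:
  assumes A: "A \<subseteq> V1" "a \<in> A" "b \<in> A" "a \<noteq> b" and small: "card (boundary E V2 A) \<le> 2"
  shows "has_cycle_of_length (M1 \<union> M2) 4"
proof -
  obtain y z where yz: "y \<noteq> z" "{a, y} \<in> M1" "{a, z} \<in> M2" "{y, z} \<subseteq> boundary E V2 A"
    using two_cross_neighbours[OF A(1,2)] .
  obtain y' z' where yz': "y' \<noteq> z'" "{b, y'} \<in> M1" "{b, z'} \<in> M2" "{y', z'} \<subseteq> boundary E V2 A"
    using two_cross_neighbours[OF A(1,3)] .
  have "{y, z} = boundary E V2 A" using yz small by (intro card_seteq finite_boundary) auto
  moreover have "{y', z'} = boundary E V2 A" using yz' small by (intro card_seteq finite_boundary) auto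
  ultimately have "{y, z} = {y', z'}" by simp
  \<comment> \<open>The matchings may trade roles at \<open>b\<close>, so only membership in the
    union is known.\<close>
  then have b: "{b, y} \<in> M1 \<union> M2" "{b, z} \<in> M1 \<union> M2" using yz' by (auto simp: doubleton_eq_iff)
  have "y \<in> V2" "z \<in> V2" using yz(4) by (auto simp: boundary_def)
  then have "distinct [a, y, b, z]" using A yz(1) disj by auto
  moreover have "{[a, y, b, z] ! i, [a, y, b, z] ! ((i + 1) mod 4)} \<in> M1 \<union> M2" if i: "i < 4" for i
  proof -
    consider "i = 0" | "i = 1" | "i = 2" | "i = 3" using i by linarith
    then show ?thesis using b yz(2,3) by cases (auto simp: insert_commute)
  qed
  moreover have "length [a, y, b, z] = 4" by simp
  ultimately show ?thesis unfolding has_cycle_of_length_def by blast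
qed

text \<open>At least two cross neighbours are gained. Equality forces exactly two, and then two
  distinct elements of \<open>A\<close> would produce a 4-cycle.\<close>

lemma excess_bound_one_side:
  assumes A: "A \<subseteq> V1" "A \<noteq> {}" and k: "k \<le> excess E1 V1 A"
  shows "k + 2 \<le> excess E V A \<and>
    (excess E V A = k + 2 \<longrightarrow> card A = 1 \<or> has_cycle_of_length (M1 \<union> M2) 4)"
proof -
  have "card A = 1 \<or> has_cycle_of_length (M1 \<union> M2) 4" if small: "card (boundary E V2 A) \<le> 2"
  proof -
    obtain a where a: "a \<in> A" using A(2) by blast
    show ?thesis
    proof (cases "A = {a}")
      case False
      then obtain b where "b \<in> A" "a \<noteq> b" using a by blast
      then show ?thesis using four_cycle[OF A(1) a _ _ small] by blast
    qed simp
  qed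
  then show ?thesis using excess_one_side[OF A] k by auto
qed

lemma excess_bound:
  assumes A: "A \<subseteq> V" "A \<noteq> {}" and k: "2 < k"
    and bound1: "\<And>B. B \<subseteq> V1 \<Longrightarrow> B \<noteq> {} \<Longrightarrow> k \<le> excess E1 V1 B"
    and bound2: "\<And>B. B \<subseteq> V2 \<Longrightarrow> B \<noteq> {} \<Longrightarrow> k \<le> excess E2 V2 B"
  shows "k + 2 \<le> excess E V A \<and>
    (excess E V A = k + 2 \<longrightarrow> card A = 1 \<or> has_cycle_of_length (M1 \<union> M2) 4)"
proof -
  consider "A \<subseteq> V1" | "A \<subseteq> V2" | "A \<inter> V1 \<noteq> {}" "A \<inter> V2 \<noteq> {}" using A(1) unfolding V_def by blast
  then show ?thesis
  proof cases
    case 1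
    then show ?thesis using excess_bound_one_side[OF 1 A(2) bound1[OF 1 A(2)]] by blast
  next
    case 2
    then show ?thesis
      using joined_graphs.excess_bound_one_side[OF swap 2 A(2) bound2[OF 2 A(2)], unfolded swap_V swap_E] by blast
  next
    case 3
    have "A = (A \<inter> V1) \<union> (A \<inter> V2)" using A(1) by (auto simp: V_def)
    then have "excess E1 V1 (A \<inter> V1) + excess E2 V2 (A \<inter> V2) \<le> excess E V A"
      using excess_both_sides[of "A \<inter> V1" "A \<inter> V2"] by simp
    moreover have "k \<le> excess E1 V1 (A \<inter> V1)" "k \<le> excess E2 V2 (A \<inter> V2)"
      using 3 by (auto intro: bound1 bound2)
    \<comment> \<open>The halves contribute at least \<open>2 * k\<close>, which exceeds
      \<open>k + 2\<close> as \<open>2 < k\<close>; equality is impossible for a set meeting both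
      halves.\<close>
    ultimately show ?thesis using k by linarith
  qed
qed

lemma degree:
  assumes d: "\<And>v. v \<in> V1 \<Longrightarrow> degree (V1, E1) v = d" "\<And>v. v \<in> V2 \<Longrightarrow> degree (V2, E2) v = d"
    and v: "v \<in> V"
  shows "degree (V, E) v = d + 2"
  using v degree1[of v] joined_graphs.degree1[OF swap, of v] d unfolding swap_V swap_E V_def by auto

end

section \<open>Evaluation of the excess in the four-dimensional augmented cube\<close>

text \<open>For a symmetric relation and distinct entries, each inner edge is counted once, at its
  earlier end.\<close>

fun inner_count :: "('a \<Rightarrow> 'a \<Rightarrow> bool) \<Rightarrow> 'a list \<Rightarrow> nat" where
  "inner_count r [] = 0"
| "inner_count r (x # xs) = length (filter (r x) xs) + inner_count r xs"

text \<open>An executable form of \<open>excess\<close>, with adjacency as a relation and sets as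
  lists, so that the finite checks can be evaluated.\<close>

definition excess_list :: "('a \<Rightarrow> 'a \<Rightarrow> bool) \<Rightarrow> 'a list \<Rightarrow> 'a list \<Rightarrow> int" where
  "excess_list r ws xs =
     int (length (filter (\<lambda>v. v \<notin> set xs \<and> (\<exists>u\<in>set xs. r u v)) ws)) +
     int (inner_count r xs) - int (length xs)"

text \<open>An edge inside \<open>x # xs\<close> either avoids \<open>x\<close> or joins it to a
  related entry of \<open>xs\<close>.\<close>

lemma card_inner_list:
  assumes G: "simple_graph G" and "distinct xs"
    and "\<And>u v. u \<in> set xs \<Longrightarrow> v \<in> set xs \<Longrightarrow> {u, v} \<in> edges G \<longleftrightarrow> r u v"
  shows "card (inner (edges G) (set xs)) = inner_count r xs"
  using assms(2,3)
proof (induction xs)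
  case Nil
  have "{} \<notin> edges G" using simple_graph_edgeE[OF G, of "{}"] by blast
  then have "inner (edges G) {} = {}" by (auto simp: inner_def)
  then show ?case by simp
next
  case (Cons x xs)
  let ?N = "(\<lambda>v. {x, v}) ` set (filter (r x) xs)"
  have adj: "{x, v} \<in> edges G \<longleftrightarrow> r x v" if "v \<in> set xs" for v
    using Cons.prems(2)[of x v] that by simp
  have "e \<in> inner (edges G) (set (x # xs)) \<longleftrightarrow> e \<in> inner (edges G) (set xs) \<union> ?N" for e
  proof
    assume e: "e \<in> inner (edges G) (set (x # xs))"
    then have eE: "e \<in> edges G" by (simp add: inner_def)
    show "e \<in> inner (edges G) (set xs) \<union> ?N"
    proof (cases "x \<in> e")
      case True
      obtain a b where "a \<noteq> b" "e = {a, b}" using simple_graph_edgeE[OF G eE] by metis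
      with True obtain v where v: "e = {x, v}" "v \<noteq> x" by (metis doubleton_eq_iff insertE singletonD)
      then have "v \<in> set xs" using e by (auto simp: inner_def)
      then show ?thesis using adj[of v] eE v(1) by auto
    next
      case False
      then show ?thesis using e by (auto simp: inner_def)
    qed
  next
    assume "e \<in> inner (edges G) (set xs) \<union> ?N"
    then show "e \<in> inner (edges G) (set (x # xs))"
    proof
      assume "e \<in> ?N"
      then obtain v where "v \<in> set xs" "r x v" "e = {x, v}" by auto
      then show ?thesis using adj[of v] by (simp add: inner_def)
    qed (auto simp: inner_def)
  qed
  then have eq: "inner (edges G) (set (x # xs)) = inner (edges G) (set xs) \<union> ?N" by blast
  have "card (inner (edges G) (set xs) \<union> ?N) = card (inner (edges G) (set xs)) + card ?N"
    using simple_graph_finite_edges[OF G] Cons.prems(1) by (intro card_Un_disjoint) (auto simp: inner_def)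
  also have "card ?N = card (set (filter (r x) xs))"
    by (intro card_image inj_onI) (auto simp: doubleton_eq_iff)
  also have "\<dots> = length (filter (r x) xs)"
    using Cons.prems(1) by (simp only: distinct_card distinct_filter distinct.simps)
  also have "card (inner (edges G) (set xs)) = inner_count r xs"
    using Cons.prems by (intro Cons.IH) auto
  finally show ?case by (simp only: eq inner_count.simps add.commute)
qed

lemma excess_eq_excess_list:
  assumes G: "simple_graph G" and dist: "distinct xs" "distinct ws" and sub: "set xs \<subseteq> set ws"
    and adj: "\<And>u v. u \<in> set ws \<Longrightarrow> v \<in> set ws \<Longrightarrow> {u, v} \<in> edges G \<longleftrightarrow> r u v"
  shows "excess (edges G) (set ws) (set xs) = excess_list r ws xs"
proof -
  have "card (inner (edges G) (set xs)) = inner_count r xs"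
    using sub by (intro card_inner_list[OF G dist(1)] adj) auto
  moreover have "boundary (edges G) (set ws) (set xs) =
      set (filter (\<lambda>v. v \<notin> set xs \<and> (\<exists>u\<in>set xs. r u v)) ws)"
    using sub adj by (auto simp: boundary_def subset_iff)
  ultimately show ?thesis
    using dist by (simp add: excess_def excess_list_def distinct_card del: set_filter)
qed

lemma aq_adj_commute: "aq_adj u v \<longleftrightarrow> aq_adj v u"
  by (induction u v rule: aq_adj.induct) (auto simp: list_all2_conv_all_nth)

lemma aq_adj_irrefl: "\<not> aq_adj u u"
  by (induction u) auto

lemma AQ_edge_iff:
  assumes "length u = n" "length v = n"
  shows "{u, v} \<in> edges (AQ n) \<longleftrightarrow> aq_adj u v"
  using assms aq_adj_commute by (fastforce simp: AQ_def edges_def doubleton_eq_iff)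

lemma AQ_simple: "simple_graph (AQ n)"
proof -
  have "finite {xs :: bool list. length xs = n}" using finite_lists_length_eq[of "UNIV :: bool set" n] by simp
  then show ?thesis using aq_adj_irrefl by (fastforce simp: simple_graph_def AQ_def verts_def edges_def)
qed

text \<open>The vertices of one of the two copies of the three-dimensional cube that make up
  \<open>AQ 4\<close>.\<close>

definition half :: "bool \<Rightarrow> bool list list" where
  "half b = map (Cons b) (List.n_lists 3 [False, True])"

text \<open>
  By superadditivity of the excess over the two halves of \<open>AQ\<^sub>4\<close>, and since every nonempty subset of a
  half has excess at least 2 there, only pairs of subsets with excess at most 4 in their own half
  can have a union of excess below 7. This cuts the \<open>2\<^sup>1\<^sup>6\<close> vertex sets to about a thousand.
\<close>

definition low_subsets :: "bool \<Rightarrow> (bool list list \<times> int) list" where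
  "low_subsets b = filter (\<lambda>(xs, p). xs \<noteq> [] \<and> p \<le> 4)
     (map (\<lambda>xs. (xs, excess_list aq_adj (half b) xs)) (subseqs (half b)))"

lemma half_excess: "\<forall>b. \<forall>xs\<in>set (subseqs (half b)). xs = [] \<or> 2 \<le> excess_list aq_adj (half b) xs"
  by code_simp

text \<open>The value 6 belongs to single vertices: 7 neighbours, no inner edge, minus 1 for the
  vertex itself.\<close>

lemma AQ4_excess_one_side:
  "\<forall>b. \<forall>xs\<in>set (subseqs (half b)). xs = [] \<or>
     7 \<le> excess_list aq_adj (half False @ half True) xs \<or>
     length xs = 1 \<and> excess_list aq_adj (half False @ half True) xs = 6"
  by code_simp

text \<open>Where \<open>p + q\<close> already reaches 7, superadditivity suffices; the union is
  examined only for the other pairs.\<close>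

lemma AQ4_excess_both_sides:
  "\<forall>(xs, p)\<in>set (low_subsets False). \<forall>(ys, q)\<in>set (low_subsets True).
     7 \<le> p + q \<or> 7 \<le> excess_list aq_adj (half False @ half True) (xs @ ys)"
  by code_simp

lemma AQ4_degree_list:
  "\<forall>u\<in>set (half False @ half True). length (filter (aq_adj u) (half False @ half True)) = 7"
  by code_simp

lemma set_half: "set (half b) = Cons b ` {xs. length xs = 3}"
proof -
  have "set xs \<subseteq> {False, True}" for xs by auto
  then show ?thesis by (auto simp: half_def set_n_lists)
qed

lemma distinct_half: "distinct (half b)"
  by (simp add: half_def distinct_map distinct_n_lists)

lemma verts_AQ4: "verts (AQ 4) = set (half False) \<union> set (half True)"
proof -
  have "length xs = 4 \<longleftrightarrow> xs \<in> set (half False) \<union> set (half True)" for xs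
    by (cases xs) (auto simp: set_half)
  then show ?thesis by (auto simp: AQ_def verts_def)
qed

lemma halves_disjoint: "set (half False) \<inter> set (half True) = {}"
  by (auto simp: set_half)

lemma AQ4_excess:
  assumes A: "A \<subseteq> verts (AQ 4)" "A \<noteq> {}"
  shows "6 \<le> excess (edges (AQ 4)) (verts (AQ 4)) A \<and>
    (excess (edges (AQ 4)) (verts (AQ 4)) A = 6 \<longrightarrow> card A = 1)"
proof -
  let ?W = "half False @ half True" and ?E = "edges (AQ 4)"
  have W: "verts (AQ 4) = set ?W" by (simp add: verts_AQ4)
  have distW: "distinct ?W" using halves_disjoint by (simp add: distinct_half)
  have len: "length u = 4" if "u \<in> set ?W" for u
    using that W by (auto simp: AQ_def verts_def)
  have to_list: "excess ?E (set ws) (set xs) = excess_list aq_adj ws xs"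
    if "distinct xs" "distinct ws" "set xs \<subseteq> set ws" "set ws \<subseteq> set ?W" for xs ws
    using that len by (intro excess_eq_excess_list[OF AQ_simple] AQ_edge_iff) auto
  have half_sub: "set (half b) \<subseteq> set ?W" for b by (cases b) auto
  have list: "\<exists>xs\<in>set (subseqs (half b)). set xs = B \<and> distinct xs" if "B \<subseteq> set (half b)" for B b
    using subset_subseqs[OF that] subseqs_distinctD[OF _ distinct_half] by auto
  have one: ?thesis if B: "A \<subseteq> set (half b)" for b
  proof -
    obtain xs where xs: "xs \<in> set (subseqs (half b))" "set xs = A" "distinct xs" using list[OF B] by blast
    have "excess ?E (set ?W) (set xs) = excess_list aq_adj ?W xs"
      using xs B half_sub[of b] by (intro to_list distW) auto
    moreover have "xs \<noteq> []" using xs A(2) by auto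
    ultimately show ?thesis
      using AQ4_excess_one_side xs distinct_card[OF xs(3)] unfolding W by fastforce
  qed
  show ?thesis
  proof (cases "A \<subseteq> set (half False) \<or> A \<subseteq> set (half True)")
    case False
    let ?A0 = "A \<inter> set (half False)" and ?A1 = "A \<inter> set (half True)"
    have A01: "A = ?A0 \<union> ?A1" using A(1) verts_AQ4 by blast
    have ne: "?A0 \<noteq> {}" "?A1 \<noteq> {}" using A01 False by auto
    obtain xs where xs: "xs \<in> set (subseqs (half False))" "set xs = ?A0" "distinct xs"
      using list[of ?A0 False] by auto
    obtain ys where ys: "ys \<in> set (subseqs (half True))" "set ys = ?A1" "distinct ys"
      using list[of ?A1 True] by auto
    define p where "p = excess_list aq_adj (half False) xs"
    define q where "q = excess_list aq_adj (half True) ys"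
    have nel: "xs \<noteq> []" "ys \<noteq> []" using ne xs(2) ys(2) by auto
    have "2 \<le> p" "2 \<le> q" using half_excess xs(1) ys(1) nel by (auto simp: p_def q_def)
    have "p = excess ?E (set (half False)) (set xs)" "q = excess ?E (set (half True)) (set ys)"
      unfolding p_def q_def
      using to_list[OF xs(3) distinct_half _ half_sub, of False] to_list[OF ys(3) distinct_half _ half_sub, of True]
        xs(2) ys(2) by simp_all
    then have sum: "p + q \<le> excess ?E (verts (AQ 4)) A"
      using excess_superadditive[OF _ simple_graph_finite_edges[OF AQ_simple] verts_AQ4 halves_disjoint, of ?A0 ?A1 4]
        simple_graph_edgeE[OF AQ_simple, of "{}" 4] A01 xs(2) ys(2) W by force
    have eq: "excess ?E (verts (AQ 4)) A = excess_list aq_adj ?W (xs @ ys)"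
    proof -
      have "set (xs @ ys) = A" using A01 xs(2) ys(2) by simp
      moreover have "distinct (xs @ ys)" using xs ys halves_disjoint by auto
      moreover have "set (xs @ ys) \<subseteq> set ?W" using xs(2) ys(2) by auto
      ultimately show ?thesis using to_list[OF _ distW, of "xs @ ys"] W by simp
    qed
    have "7 \<le> excess ?E (verts (AQ 4)) A"
    proof (cases "7 \<le> p + q")
      case small: False
      \<comment> \<open>From \<open>p + q \<le> 6\<close> and both values being at least 2, neither
        exceeds 4.\<close>
      then have "(xs, p) \<in> set (low_subsets False)" "(ys, q) \<in> set (low_subsets True)"
        using \<open>2 \<le> p\<close> \<open>2 \<le> q\<close> xs(1) ys(1) nel by (auto simp: low_subsets_def p_def q_def)
      then show ?thesis using AQ4_excess_both_sides small eq by fastforce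
    qed (use sum in linarith)
    then show ?thesis by simp
  qed (use one in blast)
qed

lemma AQ4_degree:
  assumes v: "v \<in> verts (AQ 4)" shows "degree (AQ 4) v = 7"
proof -
  let ?W = "half False @ half True"
  have W: "verts (AQ 4) = set ?W" by (simp add: verts_AQ4)
  have len: "length u = 4" if "u \<in> verts (AQ 4)" for u using that by (simp add: AQ_def verts_def)
  have "e \<in> {e \<in> edges (AQ 4). v \<in> e} \<longleftrightarrow> e \<in> (\<lambda>w. {v, w}) ` set (filter (aq_adj v) ?W)" for e
  proof
    assume e: "e \<in> {e \<in> edges (AQ 4). v \<in> e}"
    then have eE: "e \<in> edges (AQ 4)" by simp
    obtain a b where ab: "a \<in> verts (AQ 4)" "b \<in> verts (AQ 4)" "e = {a, b}"
      using simple_graph_edgeE[OF AQ_simple eE] by metis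
    then obtain w where "w \<in> verts (AQ 4)" "e = {v, w}" using e by (auto simp: insert_commute)
    then show "e \<in> (\<lambda>w. {v, w}) ` set (filter (aq_adj v) ?W)"
      using eE AQ_edge_iff[OF len len] v W by auto
  next
    assume "e \<in> (\<lambda>w. {v, w}) ` set (filter (aq_adj v) ?W)"
    then obtain w where "w \<in> verts (AQ 4)" "aq_adj v w" "e = {v, w}" using W by auto
    then show "e \<in> {e \<in> edges (AQ 4). v \<in> e}" using AQ_edge_iff[OF len len] v by simp
  qed
  then have "{e \<in> edges (AQ 4). v \<in> e} = (\<lambda>w. {v, w}) ` set (filter (aq_adj v) ?W)" by blast
  moreover have "card ((\<lambda>w. {v, w}) ` set (filter (aq_adj v) ?W)) = card (set (filter (aq_adj v) ?W))"
    by (intro card_image inj_onI) (auto simp: doubleton_eq_iff)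
  moreover have "card (set (filter (aq_adj v) ?W)) = length (filter (aq_adj v) ?W)"
    using halves_disjoint by (intro distinct_card distinct_filter) (simp add: distinct_half)
  moreover have "length (filter (aq_adj v) ?W) = 7" using AQ4_degree_list v W by blast
  ultimately show ?thesis by (simp add: degree_def)
qed

section \<open>Invariance under graph isomorphism\<close>

locale isomorphic_graphs =
  fixes G :: "'a graph" and H :: "'b graph" and f :: "'a \<Rightarrow> 'b"
  assumes G: "simple_graph G" and bij: "bij_betw f (verts G) (verts H)"
    and img: "(\<lambda>e. f ` e) ` edges G = edges H"
begin

lemma inj: "inj_on f (verts G)" and verts_image: "verts H = f ` verts G"
  using bij by (auto simp: bij_betw_def)

lemma edge_subset: "e \<in> edges G \<Longrightarrow> e \<subseteq> verts G"
  using simple_graph_edgeE[OF G, of e] by blast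

lemma image_mem_edges_iff:
  assumes "e \<subseteq> verts G" shows "f ` e \<in> edges H \<longleftrightarrow> e \<in> edges G"
proof
  assume "f ` e \<in> edges H"
  then obtain e' where e': "e' \<in> edges G" "f ` e = f ` e'" unfolding img[symmetric] by blast
  then have "e = e'" using inj_on_image_eq_iff[OF inj assms edge_subset[OF e'(1)]] by simp
  then show "e \<in> edges G" using e' by simp
qed (auto simp flip: img)

lemma simple: "simple_graph H"
proof -
  have "\<exists>u\<in>verts H. \<exists>v\<in>verts H. u \<noteq> v \<and> e = {u, v}" if e: "e \<in> edges H" for e
  proof -
    obtain e' where e': "e' \<in> edges G" "e = f ` e'" using e unfolding img[symmetric] by blast
    obtain u v where uv: "u \<in> verts G" "v \<in> verts G" "u \<noteq> v" "e' = {u, v}"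
      using simple_graph_edgeE[OF G e'(1)] .
    have "f u \<noteq> f v" using inj uv by (auto dest: inj_onD)
    then show ?thesis using uv e'(2) verts_image by auto
  qed
  moreover have "finite (verts H)" using G verts_image by (simp add: simple_graph_def)
  ultimately show ?thesis by (simp add: simple_graph_def)
qed

lemma inj_on_edges: "S \<subseteq> edges G \<Longrightarrow> inj_on (\<lambda>e. f ` e) S"
  using edge_subset by (intro inj_on_subset[OF inj_on_image_Pow[OF inj]]) auto

lemma degree_image:
  assumes v: "v \<in> verts G" shows "degree H (f v) = degree G v"
proof -
  have "f v \<in> f ` e \<longleftrightarrow> v \<in> e" if "e \<in> edges G" for e
    using inj_on_image_mem_iff[OF inj v edge_subset[OF that]] .
  then have "{e \<in> edges H. f v \<in> e} = (\<lambda>e. f ` e) ` {e \<in> edges G. v \<in> e}"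
    unfolding img[symmetric] by auto
  then show ?thesis by (simp add: degree_def card_image inj_on_edges)
qed

text \<open>Boundary, inner edges and the set itself are carried over by \<open>f\<close> or by its
  action on edges, both injective.\<close>

lemma excess_image:
  assumes B: "B \<subseteq> verts G"
  shows "excess (edges H) (verts H) (f ` B) = excess (edges G) (verts G) B"
proof -
  have adj: "{f u, f v} \<in> edges H \<longleftrightarrow> {u, v} \<in> edges G" if "u \<in> verts G" "v \<in> verts G" for u v
    using image_mem_edges_iff[of "{u, v}"] that by simp
  have mem: "f v \<in> f ` B \<longleftrightarrow> v \<in> B" if "v \<in> verts G" for v
    using inj_on_image_mem_iff[OF inj that B] .
  have "boundary (edges H) (verts H) (f ` B) = f ` boundary (edges G) (verts G) B"
    using adj mem B unfolding boundary_def verts_image by (auto simp: subset_iff intro!: imageI dest: inj_onD[OF inj])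
  moreover have "inj_on f (boundary (edges G) (verts G) B)"
    by (intro inj_on_subset[OF inj]) (auto simp: boundary_def)
  moreover have "inner (edges H) (f ` B) = (\<lambda>e. f ` e) ` inner (edges G) B"
  proof -
    have "f ` e \<subseteq> f ` B \<longleftrightarrow> e \<subseteq> B" if "e \<in> edges G" for e
      using mem edge_subset[OF that] by blast
    then show ?thesis unfolding inner_def img[symmetric] by auto
  qed
  moreover have "inj_on (\<lambda>e. f ` e) (inner (edges G) B)"
    by (intro inj_on_edges) (auto simp: inner_def)
  moreover have "inj_on f B" by (rule inj_on_subset[OF inj B])
  ultimately show ?thesis by (simp add: excess_def card_image)
qed

end

lemma iso_AQ4:
  assumes "graph_iso (AQ 4) G"
  shows "simple_graph G" "verts G \<noteq> {}" "v \<in> verts G \<Longrightarrow> degree G v = 7"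
    "A \<subseteq> verts G \<Longrightarrow> A \<noteq> {} \<Longrightarrow> 6 \<le> excess (edges G) (verts G) A \<and>
       (excess (edges G) (verts G) A = 6 \<longrightarrow> card A = 1)"
proof -
  obtain f where "bij_betw f (verts (AQ 4)) (verts G)" "(\<lambda>e. f ` e) ` edges (AQ 4) = edges G"
    using assms unfolding graph_iso_def by blast
  then interpret isomorphic_graphs "AQ 4" G f
    using AQ_simple by unfold_locales
  show "simple_graph G" by (rule simple)
  have "replicate 4 True \<in> verts (AQ 4)" by (simp add: AQ_def verts_def)
  then show "verts G \<noteq> {}" unfolding verts_image by blast
  show "degree G v = 7" if "v \<in> verts G"
    using that AQ4_degree degree_image unfolding verts_image by auto
  assume A: "A \<subseteq> verts G" "A \<noteq> {}"
  then obtain B where B: "B \<subseteq> verts (AQ 4)" "A = f ` B" unfolding verts_image by (auto simp: subset_image_iff)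
  moreover have "card A = card B" using B inj by (auto intro: card_image inj_on_subset)
  ultimately show "6 \<le> excess (edges G) (verts G) A \<and> (excess (edges G) (verts G) A = 6 \<longrightarrow> card A = 1)"
    using AQ4_excess[OF B(1)] A(2) by (simp add: excess_image)
qed

section \<open>Induction over the construction of generalized augmented cubes\<close>

text \<open>Degree and excess bound start at 7 and 6 and both grow by 2 per step. Simplicity and
  \<open>4 \<le> n\<close> are carried along to enter the join and to keep \<open>2 * n - 1\<close>
  free of truncation.\<close>

lemma gaq_properties:
  assumes "gaq n G"
  shows "simple_graph G \<and> verts G \<noteq> {} \<and> 4 \<le> n \<and> (\<forall>v\<in>verts G. degree G v = 2 * n - 1) \<and>
    (\<forall>A. A \<subseteq> verts G \<longrightarrow> A \<noteq> {} \<longrightarrow> 2 * int n - 2 \<le> excess (edges G) (verts G) A)"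
  using assms
proof induction
  case (base G)
  show ?case using iso_AQ4[OF base] by auto
next
  case (step n V1 E1 V2 E2 M1 M2)
  interpret joined_graphs V1 V2 E1 E2 M1 M2
    using step by unfold_locales auto
  have VE: "(V1 \<union> V2, E1 \<union> E2 \<union> M1 \<union> M2) = (V, E)" by (simp add: V_def E_def)
  \<comment> \<open>The bound for the halves, at dimension \<open>n - 1\<close>; it is at least 6
    because \<open>5 \<le> n\<close>, hence above the 2 that \<open>excess_bound\<close>
    demands.\<close>
  let ?k = "2 * int n - 4"
  have k: "2 * int (n - 1) - 2 = ?k" using step.hyps(1) by simp
  have b1: "?k \<le> excess E1 V1 B" if "B \<subseteq> V1" "B \<noteq> {}" for B
    using step.IH(1) that unfolding k verts_def edges_def fst_conv snd_conv by blast
  have b2: "?k \<le> excess E2 V2 B" if "B \<subseteq> V2" "B \<noteq> {}" for B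
    using step.IH(2) that unfolding k verts_def edges_def fst_conv snd_conv by blast
  have "2 * int n - 2 \<le> excess E V A" if "A \<subseteq> V" "A \<noteq> {}" for A
    using excess_bound[OF that _ b1 b2] step.hyps(1) by simp
  moreover have "degree (V, E) v = 2 * n - 1" if "v \<in> V" for v
    using degree[of "2 * (n - 1) - 1" v] that step.IH step.hyps(1) by (simp add: verts_def)
  moreover have "V \<noteq> {}" using step.IH by (simp add: verts_def V_def)
  ultimately show ?case using simple step.hyps(1) unfolding VE by (simp add: verts_def edges_def)
qed

text \<open>The restriction concerns the last join alone, so the halves supply the general bound,
  and the missing 4-cycle leaves only singletons in the equality case.\<close>

lemma rgaq_excess:
  assumes "rgaq n G" "A \<subseteq> verts G" "A \<noteq> {}" "excess (edges G) (verts G) A = 2 * int n - 2"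
  shows "card A = 1"
proof (cases "n = 4")
  case True
  then show ?thesis using assms iso_AQ4(4)[of G A] by (simp add: rgaq_def)
next
  case False
  then obtain V1 E1 V2 E2 M1 M2 where n: "5 \<le> n"
    and G: "G = (V1 \<union> V2, E1 \<union> E2 \<union> M1 \<union> M2)"
    and gaq: "gaq (n - 1) (V1, E1)" "gaq (n - 1) (V2, E2)"
    and M: "V1 \<inter> V2 = {}" "perfect_matching_between V1 V2 M1" "perfect_matching_between V1 V2 M2"
      "M1 \<inter> M2 = {}" "\<not> has_cycle_of_length (M1 \<union> M2) 4"
    using assms(1) unfolding rgaq_def by blast
  note props = gaq_properties[OF gaq(1)] gaq_properties[OF gaq(2)]
  interpret joined_graphs V1 V2 E1 E2 M1 M2
    using props M by unfold_locales auto
  have G': "verts G = V" "edges G = E" by (simp_all add: G verts_def edges_def V_def E_def)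
  let ?k = "2 * int n - 4"
  have k: "2 * int (n - 1) - 2 = ?k" using n by simp
  have b1: "?k \<le> excess E1 V1 B" if "B \<subseteq> V1" "B \<noteq> {}" for B
    using props(1) that unfolding k verts_def edges_def fst_conv snd_conv by blast
  have b2: "?k \<le> excess E2 V2 B" if "B \<subseteq> V2" "B \<noteq> {}" for B
    using props(2) that unfolding k verts_def edges_def fst_conv snd_conv by blast
  show ?thesis
    using excess_bound[OF _ assms(3) _ b1 b2] assms(2,4) n M(5) unfolding G' by auto
qed

lemma rgaq_imp_gaq: "rgaq n G \<Longrightarrow> gaq n G"
  unfolding rgaq_def by (auto intro: gaq.intros)

section \<open>Preclusion numbers and optimal preclusion sets\<close>

text \<open>The weights at \<open>v\<close> become an empty sum, which is 0 instead of 1. This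
  bounds \<open>fsmp\<close> above by any degree.\<close>

lemma fsmp_set_edges_at_vertex:
  fixes G :: "'a graph"
  assumes v: "v \<in> verts G" shows "fsmp_set G {} {e \<in> edges G. v \<in> e}"
proof -
  let ?H = "delete G {} {e \<in> edges G. v \<in> e}"
  have none: "{e \<in> edges ?H. v \<in> e} = {}" by (auto simp: delete_def edges_def)
  have "v \<in> verts ?H" using v by (simp add: delete_def verts_def)
  moreover have "(\<Sum>e\<in>{e \<in> edges ?H. v \<in> e}. f e) \<noteq> 1" for f :: "'a set \<Rightarrow> real"
    by (simp only: none sum.empty zero_neq_one not_False_eq_True)
  ultimately have "\<not> has_fractional_perfect_matching ?H"
    unfolding has_fractional_perfect_matching_def by blast
  then show ?thesis by (auto simp: fsmp_set_def)
qed

lemma regular_fsmp: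
  assumes G: "simple_graph G" "verts G \<noteq> {}" and deg: "\<And>v. v \<in> verts G \<Longrightarrow> degree G v = d"
    and bound: "\<And>A. A \<subseteq> verts G \<Longrightarrow> A \<noteq> {} \<Longrightarrow> int d - 1 \<le> excess (edges G) (verts G) A"
  shows "fsmp G = d" "min_degree G = d"
proof -
  obtain v where v: "v \<in> verts G" using G(2) by blast
  show "fsmp G = d" unfolding fsmp_def
  proof (rule Least_equality)
    show "\<exists>FV FE. fsmp_set G FV FE \<and> card FV + card FE = d"
      using fsmp_set_edges_at_vertex[OF v] deg[OF v] unfolding degree_def
      by (metis add_0 card.empty)
  next
    fix k assume "\<exists>FV FE. fsmp_set G FV FE \<and> card FV + card FE = k"
    then obtain FV FE where F: "fsmp_set G FV FE" "card FV + card FE = k" by blast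
    obtain A where "A \<subseteq> verts G" "A \<noteq> {}" "excess (edges G) (verts G) A < int (card FV + card FE)"
      using fsmp_set_excess[OF G(1) F(1)] by metis
    \<comment> \<open>The strict inequality of \<open>fsmp_set_excess\<close> makes up for the 1 by
      which the excess bound falls short of \<open>d\<close>.\<close>
    then show "d \<le> k" using bound[of A] F(2) by linarith
  qed
  have "degree G ` verts G = {d}" using deg v by force
  then show "min_degree G = d" by (simp add: min_degree_def)
qed

lemma gaq_fsmp:
  assumes "gaq n G"
  shows "fsmp G = 2 * n - 1" "min_degree G = 2 * n - 1"
proof -
  note props = gaq_properties[OF assms]
  have "int (2 * n - 1) - 1 = 2 * int n - 2" using props by auto
  then show "fsmp G = 2 * n - 1" "min_degree G = 2 * n - 1"
    using regular_fsmp[of G "2 * n - 1"] props by auto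
qed

lemma rgaq_super_matched:
  assumes "rgaq n G"
  shows "frac_strongly_super_matched G"
proof -
  note gaq = rgaq_imp_gaq[OF assms]
  note props = gaq_properties[OF gaq]
  have simple: "simple_graph G" using props by blast
  have "has_isolated_vertex (delete G FV FE)" if F: "optimal_fsmp_set G FV FE" for FV FE
  proof -
    have F': "fsmp_set G FV FE" "card FV + card FE = 2 * n - 1"
      using F gaq_fsmp(1)[OF gaq] by (auto simp: optimal_fsmp_set_def)
    obtain A where A: "A \<subseteq> verts G" "A \<noteq> {}" "excess (edges G) (verts G) A < int (card FV + card FE)"
      "card A = 1 \<Longrightarrow> has_isolated_vertex (delete G FV FE)"
      using fsmp_set_excess[OF simple F'(1)] by metis
    have "2 * int n - 2 \<le> excess (edges G) (verts G) A" using props A(1,2) by blast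
    \<comment> \<open>The excess is below \<open>2 * n - 1\<close>, the size of an optimal set, so
      the lower bound is attained and \<open>A\<close> is a singleton.\<close>
    then have "excess (edges G) (verts G) A = 2 * int n - 2"
      using A(3) F'(2) props by auto
    then show ?thesis using A(4) rgaq_excess[OF assms A(1,2)] by blast
  qed
  then show ?thesis
    using gaq_fsmp[OF gaq] by (simp add: frac_strongly_super_matched_def frac_strongly_maximally_matched_def)
qed

theorem theorem3p10:
  shows "(\<forall>(n::nat) (G::'a graph). 4 \<le> n \<and> gaq n G \<longrightarrow>
             frac_strongly_maximally_matched G \<and> fsmp G = 2 * n - 1) \<and>
         (\<forall>(n::nat) (G::'a graph). 4 \<le> n \<and> rgaq n G \<longrightarrow>
             frac_strongly_super_matched G)"
proof (intro conjI allI impI)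
  fix n and G :: "'a graph"
  assume "4 \<le> n \<and> gaq n G"
  then have "gaq n G" by blast
  note fsmp = gaq_fsmp[OF this]
  show "frac_strongly_maximally_matched G" by (simp only: fsmp frac_strongly_maximally_matched_def)
  show "fsmp G = 2 * n - 1" by (rule fsmp)
qed (use rgaq_super_matched in blast)

end
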